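(* Let $b>0$ and suppose the learner-optimal parameter $w_\ell^*(D)\in[0,1]$ has a continuous prior $\pi_w$ with full support on $[0,1]$. For $t\in(0,1)$ define $$\Phi_L(t)=\mathbb E_{\pi_w}[w_\ell^*(D)\mid w_\ell^*(D)\in[0,t]],\qquad \Phi_H(t)=\mathbb E_{\pi_w}[w_\ell^*(D)\mid w_\ell^*(D)\in(t,1]].$$ Then learning is influential if and only if there exists $t\in(0,1)$ such that $$t+b=\frac{\Phi_L(t)+\Phi_H(t)}{2}.$$
   Context: Game. A user holds a private dataset $D$; the only payoff-relevant information in it is the learner-optimal parameter $w_\ell^*(D)\in[0,1]$, which is distributed according to a commonly known prior $\pi_w$ ("continuous" means atomless). The user observes $w_\ell^*(D)$ and sends a report $M$ from a report space $\mathcal M$ (reports are costless and unverifiable; $\mathcal M$ is rich enough to name any measurable region of the parameter space). The learner observes only $M$ and chooses a deployed parameter $w\in[0,1]$. Utilities are $$U^\ell(D,w)=-|w-w_\ell^*(D)|^2,\qquad U^r(D,w)=-|w-(w_\ell^*(D)+b)|^2$$ for the learner and the user respectively. Strategies. A user strategy $\sigma_r(\cdot\mid x)$ assigns to each value $x$ of $w_\ell^*(D)$ a probability distribution on $\mathcal M$; a learner strategy $\sigma_\ell(\cdot\mid M)$ assigns to each report a probability distribution on $[0,1]$. The learner's belief $\Phi(\cdot\mid M)$ is the conditional distribution of $w_\ell^*(D)$ given $M$ obtained by Bayes' rule from $\pi_w$ and $\sigma_r$ (for reports that are not sent under $\sigma_r$, any belief on $[0,1]$ is allowed). Equilibrium.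 $(\sigma_r,\sigma_\ell)$ (with such beliefs) is an equilibrium if every report used at a value of $w_\ell^*(D)$ maximizes the user's expected utility $M'\mapsto \mathbb E_{w\sim\sigma_\ell(\cdot\mid M')}[U^r(D,w)]$ over $\mathcal M$, and every parameter used by the learner after $M$ maximizes the learner's expected utility $w'\mapsto\mathbb E_{D\sim\Phi(\cdot\mid M)}[U^\ell(D,w')]$. Influence. An equilibrium is influential if there are two distinct reports $M,M'$, both sent with positive probability under $(\sigma_r,\pi_w)$, with $\sigma_\ell(\cdot\mid M)\neq\sigma_\ell(\cdot\mid M')$. "Learning is influential" means that at least one influential equilibrium exists. *)

theory Defs
  imports "HOL-Probability.Probability" "HOL-Library.Equipollence"
begin

text \<open>
  The dataset enters the game only through the value \<open>x\<close> of the learner-optimal parameter, which is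
  therefore used as the user's type.  Types and deployed parameters both live in the unit interval
  with its Borel sigma-algebra.
\<close>

abbreviation param_space :: "real measure" where
  "param_space \<equiv> restrict_space borel {0..1}"

definition learner_utility :: "real \<Rightarrow> real \<Rightarrow> real" where
  "learner_utility x w = - (\<bar>w - x\<bar>\<^sup>2)"

definition user_utility :: "real \<Rightarrow> real \<Rightarrow> real \<Rightarrow> real" where
  "user_utility b x w = - (\<bar>w - (x + b)\<bar>\<^sup>2)"

text \<open>
  The report space is an arbitrary measurable space in which every measurable set of parameters can
  be given a name of its own, i.e. there is an injection from these sets into the reports.
  Singletons are required to be measurable so that the probability of sending one given report
  is meaningful.
\<close>

definition rich_report_space :: "'m measure \<Rightarrow> bool" where
  "rich_report_space R \<longleftrightarrow>
     (\<forall>m\<in>space R. {m} \<in> sets R) \<and> sets param_space \<lesssim> space R"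

definition user_strategy :: "'m measure \<Rightarrow> (real \<Rightarrow> 'm measure) \<Rightarrow> bool" where
  "user_strategy R \<sigma>r \<longleftrightarrow> \<sigma>r \<in> param_space \<rightarrow>\<^sub>M prob_algebra R"

definition learner_strategy :: "'m measure \<Rightarrow> ('m \<Rightarrow> real measure) \<Rightarrow> bool" where
  "learner_strategy R \<sigma>l \<longleftrightarrow> \<sigma>l \<in> R \<rightarrow>\<^sub>M prob_algebra param_space"

definition report_distr :: "real measure \<Rightarrow> (real \<Rightarrow> 'm measure) \<Rightarrow> 'm measure" where
  "report_distr \<pi> \<sigma>r = \<pi> \<bind> \<sigma>r"

text \<open>
  Bayes' rule for possibly non-discrete reports: \<open>\<Phi>\<close> is a version of the regular conditional
  distribution of the type given the report, that is, both sides below are the probability that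
  the type lies in \<open>A\<close> and the report lies in \<open>B\<close>.  This leaves \<open>\<Phi>\<close> free on reports that are not
  sent, and determines \<open>\<Phi> m\<close> to be the elementary conditional distribution whenever \<open>m\<close> has
  positive probability.
\<close>

definition bayes_belief ::
    "'m measure \<Rightarrow> real measure \<Rightarrow> (real \<Rightarrow> 'm measure) \<Rightarrow> ('m \<Rightarrow> real measure) \<Rightarrow> bool" where
  "bayes_belief R \<pi> \<sigma>r \<Phi> \<longleftrightarrow>
     \<Phi> \<in> R \<rightarrow>\<^sub>M prob_algebra param_space \<and>
     (\<forall>A\<in>sets param_space. \<forall>B\<in>sets R.
        (\<integral>\<^sup>+x\<in>A. emeasure (\<sigma>r x) B \<partial>\<pi>) = (\<integral>\<^sup>+m\<in>B. emeasure (\<Phi> m) A \<partial>report_distr \<pi> \<sigma>r))"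

text \<open>
  The reports used at \<open>x\<close> and the parameters used after \<open>m\<close> are those drawn from \<open>\<sigma>r x\<close> and \<open>\<sigma>l m\<close>;
  with possibly non-discrete mixing this is read almost surely with respect to that draw.  The
  optimality itself is demanded at every type and after every report, sent or not.
\<close>

definition user_optimal ::
    "real \<Rightarrow> 'm measure \<Rightarrow> (real \<Rightarrow> 'm measure) \<Rightarrow> ('m \<Rightarrow> real measure) \<Rightarrow> bool" where
  "user_optimal b R \<sigma>r \<sigma>l \<longleftrightarrow>
     (\<forall>x\<in>{0..1}. AE m in \<sigma>r x.
        is_arg_max (\<lambda>m'. \<integral>w. user_utility b x w \<partial>\<sigma>l m') (\<lambda>m'. m' \<in> space R) m)"

definition learner_optimal ::
    "'m measure \<Rightarrow> ('m \<Rightarrow> real measure) \<Rightarrow> ('m \<Rightarrow> real measure) \<Rightarrow> bool" where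
  "learner_optimal R \<sigma>l \<Phi> \<longleftrightarrow>
     (\<forall>m\<in>space R. AE w in \<sigma>l m.
        is_arg_max (\<lambda>w'. \<integral>x. learner_utility x w' \<partial>\<Phi> m) (\<lambda>w'. w' \<in> {0..1}) w)"

definition equilibrium ::
    "real \<Rightarrow> 'm measure \<Rightarrow> real measure \<Rightarrow> (real \<Rightarrow> 'm measure) \<Rightarrow> ('m \<Rightarrow> real measure) \<Rightarrow> bool" where
  "equilibrium b R \<pi> \<sigma>r \<sigma>l \<longleftrightarrow>
     user_strategy R \<sigma>r \<and> learner_strategy R \<sigma>l \<and> user_optimal b R \<sigma>r \<sigma>l \<and>
     (\<exists>\<Phi>. bayes_belief R \<pi> \<sigma>r \<Phi> \<and> learner_optimal R \<sigma>l \<Phi>)"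

definition influential ::
    "'m measure \<Rightarrow> real measure \<Rightarrow> (real \<Rightarrow> 'm measure) \<Rightarrow> ('m \<Rightarrow> real measure) \<Rightarrow> bool" where
  "influential R \<pi> \<sigma>r \<sigma>l \<longleftrightarrow>
     (\<exists>m\<in>space R. \<exists>m'\<in>space R. m \<noteq> m' \<and>
        measure (report_distr \<pi> \<sigma>r) {m} > 0 \<and> measure (report_distr \<pi> \<sigma>r) {m'} > 0 \<and>
        \<sigma>l m \<noteq> \<sigma>l m')"

definition learning_influential :: "real \<Rightarrow> 'm measure \<Rightarrow> real measure \<Rightarrow> bool" where
  "learning_influential b R \<pi> \<longleftrightarrow>
     (\<exists>\<sigma>r \<sigma>l. equilibrium b R \<pi> \<sigma>r \<sigma>l \<and> influential R \<pi> \<sigma>r \<sigma>l)"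

definition atomless :: "real measure \<Rightarrow> bool" where
  "atomless \<pi> \<longleftrightarrow> (\<forall>x\<in>space \<pi>. measure \<pi> {x} = 0)"

definition full_support :: "real measure \<Rightarrow> bool" where
  "full_support \<pi> \<longleftrightarrow> (\<forall>U. open U \<and> U \<inter> {0..1} \<noteq> {} \<longrightarrow> measure \<pi> (U \<inter> {0..1}) > 0)"

definition cond_mean :: "real measure \<Rightarrow> real set \<Rightarrow> real" where
  "cond_mean \<pi> A = (LINT x:A|\<pi>. x) / measure \<pi> A"

definition Phi_L :: "real measure \<Rightarrow> real \<Rightarrow> real" where
  "Phi_L \<pi> t = cond_mean \<pi> {0..t}"

definition Phi_H :: "real measure \<Rightarrow> real \<Rightarrow> real" where
  "Phi_H \<pi> t = cond_mean \<pi> {t<..1}"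

end

(* If the balance equation holds at t, two reports naming the cells [0,t] and (t,1] form an
   equilibrium, since type t is indifferent between the two cell means.

   Conversely, let X be the type and Y the induced action. The learner plays the posterior mean, so
   E[X | Y] = Y, and the user picks an available action nearest to X + b. Let L be the essential
   infimum of Y. No action q is available in (L, L + 2b): every sender of an action Y in [L, q)
   prefers it to q, which forces X < Y there, against E[X | Y] = Y. Hence L is an atom of Y, and with q the
   least available action above L and t = (L + q)/2 - b we get {Y = L} = {X <= t} almost surely.
   Thus Phi_L(t) = L and Phi_H(t) >= q, that is, t + b <= (Phi_L(t) + Phi_H(t))/2. The opposite
   inequality holds near 1, and both sides are continuous because the prior is atomless. *)

theory Submission
  imports Defs
begin

section \<open>The senders of the lowest action\<close>

text \<open>The game reduced to two random variables: \<open>opt\<close> is the user's best response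
  among the available actions \<open>S\<close>, and \<open>mean\<close> is E[X | Y] = Y tested on
  Borel sets. Closedness of \<open>S\<close> makes the least action above the gap itself available.
  The conclusions keep conditional means in product form, ready to be read off as integrals against
  the prior.\<close>

lemma (in prob_space) lowest_action_cutoff:
  fixes X Y :: "'a \<Rightarrow> real"
  assumes [measurable]: "random_variable borel X" "random_variable borel Y"
    and X01: "AE \<omega> in M. X \<omega> \<in> {0..1}" and Y01: "AE \<omega> in M. Y \<omega> \<in> {0..1}"
    and "b > 0" and "closed S"
    and opt: "AE \<omega> in M. Y \<omega> \<in> S \<and> (\<forall>s\<in>S. \<bar>Y \<omega> - (X \<omega> + b)\<bar> \<le> \<bar>s - (X \<omega> + b)\<bar>)"
    and mean: "\<And>A. A \<in> sets borel \<Longrightarrow>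
      (\<integral>\<omega>. indicator A (Y \<omega>) * X \<omega> \<partial>M) = (\<integral>\<omega>. indicator A (Y \<omega>) * Y \<omega> \<partial>M)"
    and atomless: "\<And>x. AE \<omega> in M. X \<omega> \<noteq> x"
    and nonconst: "\<And>c. \<not> (AE \<omega> in M. Y \<omega> = c)"
  obtains t L q where "0 < prob {\<omega>\<in>space M. X \<omega> \<le> t}" "0 < prob {\<omega>\<in>space M. t < X \<omega>}"
    "(\<integral>\<omega>. indicator {..t} (X \<omega>) * X \<omega> \<partial>M) = L * prob {\<omega>\<in>space M. X \<omega> \<le> t}"
    "q * prob {\<omega>\<in>space M. t < X \<omega>} \<le> (\<integral>\<omega>. indicator {t<..} (X \<omega>) * X \<omega> \<partial>M)"
    "L + q = 2 * (t + b)"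
proof -
  have bdd: "integrable M (\<lambda>\<omega>. indicator A (Z \<omega>) * W \<omega>)"
    if [measurable]: "A \<in> sets borel" "random_variable borel Z" "random_variable borel W"
      and W: "AE \<omega> in M. W \<omega> \<in> {0..1}" for A and Z W :: "'a \<Rightarrow> real"
    by (rule integrable_const_bound[where B=1])
       (use W in \<open>auto simp: indicator_def\<close>)
  \<comment> \<open>The numbers that fail to be almost sure lower bounds of \<open>Y\<close>; their
    infimum is its essential infimum. \<open>C\<close> is nonempty and bounded below because
    \<open>Y\<close> stays in the unit interval.\<close>
  define C where "C = {c. \<not> (AE \<omega> in M. c \<le> Y \<omega>)}"
  define L where "L = Inf C"
  have C_lower: "0 \<le> c" if "c \<in> C" for c
  proof (rule ccontr)
    assume "\<not> 0 \<le> c"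
    then have "AE \<omega> in M. c \<le> Y \<omega>" using Y01 by auto
    then show False using that by (simp add: C_def)
  qed
  then have C_bdd: "bdd_below C" by (rule bdd_belowI)
  have "2 \<in> C"
  proof (rule ccontr)
    assume "2 \<notin> C"
    then have "AE \<omega> in M. (2::real) \<le> Y \<omega>" by (simp add: C_def)
    then have "AE \<omega> in M. False" using Y01 by eventually_elim auto
    then show False by simp
  qed
  then have "C \<noteq> {}" by auto
  have below_C: "AE \<omega> in M. c \<le> Y \<omega>" if "c < L" for c
    using that cInf_lower[OF _ C_bdd, of c] by (force simp: C_def L_def)
  \<comment> \<open>Almost sure statements survive only countable intersections, so the bound at
    \<open>L\<close> itself is reached along the sequence L - 1/(n+1).\<close>
  have "AE \<omega> in M. \<forall>n. L - 1 / Suc n \<le> Y \<omega>"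
    by (subst AE_all_countable) (auto intro!: below_C)
  then have geL: "AE \<omega> in M. L \<le> Y \<omega>"
  proof eventually_elim
    case (elim \<omega>)
    show ?case
    proof (rule field_le_epsilon)
      fix e :: real assume "e > 0"
      then obtain n where "inverse (real (Suc n)) < e" using reals_Archimedean by blast
      then show "L \<le> Y \<omega> + e" using elim[rule_format, of n] by (simp add: inverse_eq_divide)
    qed
  qed
  have above_C: "\<not> (AE \<omega> in M. c \<le> Y \<omega>)" if c: "L < c" for c
  proof -
    obtain d where "d \<in> C" "d < c"
      using c \<open>C \<noteq> {}\<close> C_bdd by (auto simp: L_def cInf_less_iff)
    moreover have "AE \<omega> in M. d \<le> Y \<omega>" if "AE \<omega> in M. c \<le> Y \<omega>"
      using that \<open>d < c\<close> by (auto elim: eventually_mono)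
    ultimately show ?thesis by (auto simp: C_def)
  qed
  \<comment> \<open>An action in the gap would be preferred, by every sender of a lower action who is not below
    that action, so those lower actions would lie above the mean of their senders.\<close>
  have gap: "L + 2 * b \<le> q" if "q \<in> S" "L < q" for q
  proof (rule ccontr)
    assume "\<not> ?thesis"
    then have q: "q < L + 2 * b" by simp
    define h where "h \<omega> = indicator {..<q} (Y \<omega>) * Y \<omega> - indicator {..<q} (Y \<omega>) * X \<omega>" for \<omega>
    \<comment> \<open>Where Y < q, preferring \<open>Y\<close> to \<open>q\<close> puts X + b at or
      below the midpoint of the two. Since q < L + 2b <= Y + 2b, that midpoint is below Y + b, hence
      X < Y.\<close>
    have pos: "AE \<omega> in M. 0 \<le> h \<omega> \<and> (Y \<omega> < q \<longrightarrow> 0 < h \<omega>)"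
      using geL opt
    proof eventually_elim
      case (elim \<omega>)
      then have "\<bar>Y \<omega> - (X \<omega> + b)\<bar> \<le> \<bar>q - (X \<omega> + b)\<bar>" using that by auto
      then show ?case using elim q by (auto simp: h_def indicator_def)
    qed
    have "integrable M h"
      unfolding h_def by (intro Bochner_Integration.integrable_diff bdd X01 Y01) auto
    moreover have "(\<integral>\<omega>. h \<omega> \<partial>M) = 0"
      unfolding h_def by (subst Bochner_Integration.integral_diff) (auto intro!: bdd X01 Y01 simp: mean)
    ultimately have "AE \<omega> in M. h \<omega> = 0"
      using pos by (subst (asm) integral_nonneg_eq_0_iff_AE) auto
    then have "AE \<omega> in M. q \<le> Y \<omega>" using pos by eventually_elim auto
    then show False using above_C[OF \<open>L < q\<close>] by blast
  qed
  have "L \<in> S"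
  proof (rule ccontr)
    assume "L \<notin> S"
    have "AE \<omega> in M. L + 2 * b \<le> Y \<omega>"
      using opt geL
    proof eventually_elim
      case (elim \<omega>)
      then show ?case using \<open>L \<notin> S\<close> gap[of "Y \<omega>"] by (metis less_eq_real_def)
    qed
    then show False using above_C[of "L + 2 * b"] \<open>b > 0\<close> by auto
  qed
  \<comment> \<open>Available actions below \<open>L\<close> are not excluded, so \<open>ST\<close>
    speaks only of those from \<open>L\<close> on. Starting \<open>T\<close> at L + 2b rather than
    just above \<open>L\<close> makes it closed, so its infimum is attained and stays away from
    \<open>L\<close>.\<close>
  define T where "T = S \<inter> {L + 2 * b..}"
  have ST: "s = L \<or> s \<in> T" if "s \<in> S" "L \<le> s" for s
    using that gap[of s] by (cases "s = L") (auto simp: T_def)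
  have "T \<noteq> {}"
  proof
    assume "T = {}"
    have "AE \<omega> in M. Y \<omega> = L"
      using opt geL by eventually_elim (use ST \<open>T = {}\<close> in blast)
    then show False using nonconst by blast
  qed
  define q where "q = Inf T"
  have "bdd_below T" by (auto simp: T_def)
  have "q \<in> T" unfolding q_def
    using \<open>T \<noteq> {}\<close> \<open>bdd_below T\<close> \<open>closed S\<close> by (intro closed_contains_Inf) (auto simp: T_def)
  have q_le: "q \<le> s" if "s \<in> T" for s
    using that \<open>bdd_below T\<close> by (auto simp: q_def cInf_lower)
  have "q \<in> S" "L < q" using \<open>q \<in> T\<close> \<open>b > 0\<close> by (auto simp: T_def)
  \<comment> \<open>The type whose ideal action t + b is the midpoint of \<open>L\<close> and
    \<open>q\<close>.\<close>
  define t where "t = (L + q) / 2 - b"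
  \<comment> \<open>Comparing \<open>Y\<close> with the two actions \<open>L\<close> and
    \<open>q\<close> suffices, whatever else \<open>S\<close> contains. The type \<open>t\<close>
    may break its tie either way, but has probability zero.\<close>
  have split: "AE \<omega> in M. (X \<omega> \<le> t \<longleftrightarrow> Y \<omega> = L) \<and> (t < X \<omega> \<longleftrightarrow> q \<le> Y \<omega>)"
    using opt geL atomless[of t]
  proof eventually_elim
    case (elim \<omega>)
    then have "\<bar>Y \<omega> - (X \<omega> + b)\<bar> \<le> \<bar>L - (X \<omega> + b)\<bar>" "\<bar>Y \<omega> - (X \<omega> + b)\<bar> \<le> \<bar>q - (X \<omega> + b)\<bar>"
      using \<open>L \<in> S\<close> \<open>q \<in> S\<close> by auto
    moreover have "Y \<omega> = L \<or> q \<le> Y \<omega>" using ST[of "Y \<omega>"] q_le elim by blast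
    ultimately show ?case using \<open>L < q\<close> elim(3) by (auto simp: t_def field_simps)
  qed
  have low: "AE \<omega> in M. indicator {..t} (X \<omega>) = (indicator {L} (Y \<omega>) :: real)"
    using split by eventually_elim (auto simp: indicator_def)
  have high: "AE \<omega> in M. indicator {t<..} (X \<omega>) = (indicator {q..} (Y \<omega>) :: real)"
    using split by eventually_elim (auto simp: indicator_def)
  have prob_ind: "prob {\<omega>\<in>space M. X \<omega> \<in> A} = (\<integral>\<omega>. indicator A (X \<omega>) \<partial>M)"
    if [measurable]: "A \<in> sets borel" for A
  proof -
    have "(\<integral>\<omega>. indicator A (X \<omega>) \<partial>M) = (\<integral>\<omega>. indicator {\<omega>\<in>space M. X \<omega> \<in> A} \<omega> \<partial>M :: real)"
      by (intro Bochner_Integration.integral_cong) (auto simp: indicator_def)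
    then show ?thesis by simp
  qed
  show thesis
  proof
    show "0 < prob {\<omega>\<in>space M. X \<omega> \<le> t}"
    proof (rule ccontr)
      assume "\<not> ?thesis"
      then have "AE \<omega> in M. \<not> X \<omega> \<le> t"
        by (subst AE_iff_measurable[OF _ refl]) (auto simp: emeasure_eq_measure not_less not_le measure_le_0_iff)
      then have "AE \<omega> in M. q \<le> Y \<omega>" using split by eventually_elim auto
      then show False using above_C \<open>L < q\<close> by blast
    qed
    show "0 < prob {\<omega>\<in>space M. t < X \<omega>}"
    proof (rule ccontr)
      assume "\<not> ?thesis"
      then have "AE \<omega> in M. \<not> t < X \<omega>"
        by (subst AE_iff_measurable[OF _ refl]) (auto simp: emeasure_eq_measure not_less not_le measure_le_0_iff)
      then have "AE \<omega> in M. Y \<omega> = L" using split by eventually_elim auto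
      then show False using nonconst by blast
    qed
    have "(\<integral>\<omega>. indicator {..t} (X \<omega>) * X \<omega> \<partial>M) = (\<integral>\<omega>. indicator {L} (Y \<omega>) * X \<omega> \<partial>M)"
      by (rule integral_cong_AE) (use low in auto)
    also have "\<dots> = (\<integral>\<omega>. indicator {L} (Y \<omega>) * Y \<omega> \<partial>M)" by (rule mean) simp
    also have "\<dots> = (\<integral>\<omega>. L * indicator {..t} (X \<omega>) \<partial>M)"
      by (rule integral_cong_AE) (use split in \<open>auto simp: indicator_def elim!: eventually_mono\<close>)
    also have "\<dots> = L * prob {\<omega>\<in>space M. X \<omega> \<le> t}"
      using prob_ind[of "{..t}"] by simp
    finally show "(\<integral>\<omega>. indicator {..t} (X \<omega>) * X \<omega> \<partial>M) = L * prob {\<omega>\<in>space M. X \<omega> \<le> t}" .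
    have "q * prob {\<omega>\<in>space M. t < X \<omega>} = (\<integral>\<omega>. q * indicator {t<..} (X \<omega>) \<partial>M)"
      using prob_ind[of "{t<..}"] by simp
    \<comment> \<open>Types above \<open>t\<close> may induce several actions, all at least
      \<open>q\<close>; hence an inequality here, against the equality for the lower cell.\<close>
    also have "\<dots> \<le> (\<integral>\<omega>. indicator {q..} (Y \<omega>) * Y \<omega> \<partial>M)"
    proof (rule integral_mono_AE)
      show "integrable M (\<lambda>\<omega>. q * indicator {t<..} (X \<omega>))"
        using bdd[of "{t<..}" X "\<lambda>_. 1"] by simp
      show "AE \<omega> in M. q * indicator {t<..} (X \<omega>) \<le> indicator {q..} (Y \<omega>) * Y \<omega>"
        using split by eventually_elim (auto simp: indicator_def)
    qed (auto intro!: bdd Y01)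
    also have "\<dots> = (\<integral>\<omega>. indicator {q..} (Y \<omega>) * X \<omega> \<partial>M)" by (rule mean[symmetric]) simp
    also have "\<dots> = (\<integral>\<omega>. indicator {t<..} (X \<omega>) * X \<omega> \<partial>M)"
      by (rule integral_cong_AE) (use high in auto)
    finally show "q * prob {\<omega>\<in>space M. t < X \<omega>} \<le> (\<integral>\<omega>. indicator {t<..} (X \<omega>) * X \<omega> \<partial>M)" .
    show "L + q = 2 * (t + b)" by (simp add: t_def)
  qed
qed

section \<open>Truncated means of a law on the unit interval\<close>

text \<open>Nothing beyond living on the parameter space is assumed, so the locale can be
  interpreted for the prior and for posterior beliefs alike.\<close>

locale type_distr =
  fixes \<pi> :: "real measure"
  assumes prior: "\<pi> \<in> space (prob_algebra param_space)"
begin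

lemma sets_type [measurable_cong]: "sets \<pi> = sets param_space"
  and prob_space_type: "prob_space \<pi>"
  using prior by (auto simp: space_prob_algebra)

lemma space_type: "space \<pi> = {0..1}"
  using sets_eq_imp_space_eq[OF sets_type] by simp

sublocale prob_space \<pi>
  by (rule prob_space_type)

lemma id_measurable [measurable]: "(\<lambda>x. x) \<in> borel_measurable \<pi>"
  by (simp add: measurable_cong_sets[OF sets_type refl] measurable_restrict_space1)

lemma measurable_if_borel: "A \<in> sets borel \<Longrightarrow> A \<subseteq> {0..1} \<Longrightarrow> A \<in> sets \<pi>"
  by (simp add: sets_type sets_restrict_space_iff)

lemma cells [measurable]:
  "t \<le> 1 \<Longrightarrow> {0..t} \<in> sets \<pi>" "0 \<le> t \<Longrightarrow> {t<..1} \<in> sets \<pi>" "{0..1} \<in> sets \<pi>"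
  by (intro measurable_if_borel; auto)+

lemma integrable_bounded:
  "f \<in> borel_measurable \<pi> \<Longrightarrow> (\<And>x. x \<in> {0..1} \<Longrightarrow> \<bar>f x\<bar> \<le> B) \<Longrightarrow> integrable \<pi> (f :: real \<Rightarrow> real)"
  by (rule integrable_const_bound[where B=B]) (auto simp: space_type intro!: AE_I2)

lemma integrable_cell: "A \<in> sets \<pi> \<Longrightarrow> integrable \<pi> (\<lambda>x. indicator A x * x)"
  by (rule integrable_bounded[where B=1]) (auto simp: indicator_def)

lemma mass_split: "t \<in> {0..1} \<Longrightarrow> measure \<pi> {0..t} + measure \<pi> {t<..1} = 1"
proof -
  assume t: "t \<in> {0..1}"
  then have "space \<pi> - {0..t} = {t<..1}" by (auto simp: space_type)
  then show ?thesis using prob_compl[of "{0..t}"] t by simp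
qed

text \<open>The numerator of a conditional mean. Unlike the quotient it is additive over disjoint
  cells and makes sense on null sets.\<close>

definition "partial_mean A = (\<integral>x. indicator A x * x \<partial>\<pi>)"

lemma cond_mean_eq: "cond_mean \<pi> A = partial_mean A / measure \<pi> A"
  by (simp add: cond_mean_def partial_mean_def set_lebesgue_integral_def)

lemma partial_mean_bounds:
  assumes [measurable]: "A \<in> sets \<pi>" and "A \<subseteq> {l..u}"
  shows "l * measure \<pi> A \<le> partial_mean A" "partial_mean A \<le> u * measure \<pi> A"
proof -
  have i: "integrable \<pi> (\<lambda>x. c * indicator A x)" for c :: real
    by (rule integrable_bounded[where B="\<bar>c\<bar>"]) (auto simp: indicator_def)
  have A: "(\<integral>x. c * indicator A x \<partial>\<pi>) = c * measure \<pi> A" for c :: real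
    by simp
  show "l * measure \<pi> A \<le> partial_mean A" "partial_mean A \<le> u * measure \<pi> A"
    unfolding A[symmetric] partial_mean_def using assms(2)
    by (intro integral_mono i integrable_cell; auto split: split_indicator)+
qed

lemma partial_mean_split:
  assumes "t \<in> {0..1}"
  shows "partial_mean {0..t} + partial_mean {t<..1} = partial_mean {0..1}"
proof -
  have "partial_mean {0..1} = (\<integral>x. indicator {0..t} x * x + indicator {t<..1} x * x \<partial>\<pi>)"
    unfolding partial_mean_def
    by (rule Bochner_Integration.integral_cong) (use assms in \<open>auto simp: indicator_def\<close>)
  also have "\<dots> = partial_mean {0..t} + partial_mean {t<..1}"
    unfolding partial_mean_def
    by (rule Bochner_Integration.integral_add) (use assms in \<open>auto intro!: integrable_cell\<close>)
  finally show ?thesis by simp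
qed

text \<open>Both cell means become quotients built from the mass and the partial mean of the lower
  cell, so continuity has to be shown for these two functions of \<open>t\<close> only.\<close>

lemma Phi_eq:
  assumes "t \<in> {0..1}"
  shows "Phi_L \<pi> t = partial_mean {0..t} / measure \<pi> {0..t}"
    and "Phi_H \<pi> t = (partial_mean {0..1} - partial_mean {0..t}) / (1 - measure \<pi> {0..t})"
proof -
  have "partial_mean {t<..1} = partial_mean {0..1} - partial_mean {0..t}"
    "measure \<pi> {t<..1} = 1 - measure \<pi> {0..t}"
    using partial_mean_split[OF assms] mass_split[OF assms] by auto
  then show "Phi_H \<pi> t = (partial_mean {0..1} - partial_mean {0..t}) / (1 - measure \<pi> {0..t})"
    by (simp only: Phi_H_def cond_mean_eq)
qed (simp add: Phi_L_def cond_mean_eq)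

lemma Phi_upper:
  assumes "t \<in> {0<..<1}" "0 < measure \<pi> {0..t}" "measure \<pi> {0..t} < 1"
  shows "Phi_L \<pi> t \<le> t" "Phi_H \<pi> t \<le> 1"
proof -
  have "{t<..1} \<subseteq> {0..1}" using assms by auto
  then show "Phi_L \<pi> t \<le> t" "Phi_H \<pi> t \<le> 1"
  using partial_mean_bounds(2)[of "{0..t}" 0 t] partial_mean_bounds(2)[of "{t<..1}" 0 1]
    mass_split[of t] assms
    by (auto simp: Phi_L_def Phi_H_def cond_mean_eq divide_simps)
qed

section \<open>Continuity in the cutoff and the balance equation\<close>

text \<open>Pushed forward to the whole line, the mass of the lower cell is a distribution function,
  which is continuous wherever its law has no atom.\<close>

lemma continuous_mass:
  assumes "atomless \<pi>"
  shows "continuous_on {0..1} (\<lambda>t. measure \<pi> {0..t})"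
proof -
  interpret D: real_distribution "distr \<pi> borel (\<lambda>x. x)"
    by (rule real_distribution_distr) simp
  have "measure (distr \<pi> borel (\<lambda>x. x)) {x} = 0" for x
  proof -
    have "(\<lambda>x. x) -` {x} \<inter> space \<pi> = (if x \<in> {0..1} then {x} else {})"
      by (auto simp: space_type)
    then show ?thesis using assms by (auto simp: measure_distr atomless_def space_type)
  qed
  then have "isCont (cdf (distr \<pi> borel (\<lambda>x. x))) t" for t
    by (simp add: D.isCont_cdf)
  then have "continuous_on {0..1} (cdf (distr \<pi> borel (\<lambda>x. x)))"
    by (simp add: continuous_at_imp_continuous_on)
  also have "?this \<longleftrightarrow> ?thesis"
    by (rule continuous_on_cong)
       (auto simp: cdf_def measure_distr space_type intro!: arg_cong2[where f=measure])
  finally show ?thesis .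
qed

text \<open>The increment of the partial mean is the integral of a function with values in the unit
  interval over the cell between the cutoffs, so the mass of that cell bounds it. This transfers
  continuity from the mass to the partial mean.\<close>

lemma partial_mean_Lipschitz:
  assumes "s \<in> {0..1}" "t \<in> {0..1}"
  shows "\<bar>partial_mean {0..t} - partial_mean {0..s}\<bar> \<le> \<bar>measure \<pi> {0..t} - measure \<pi> {0..s}\<bar>"
proof -
  have *: "\<bar>partial_mean {0..t} - partial_mean {0..s}\<bar> \<le> \<bar>measure \<pi> {0..t} - measure \<pi> {0..s}\<bar>"
    if "0 \<le> s" "s \<le> t" "t \<le> 1" for s t
  proof -
    have [measurable]: "{s<..t} \<in> sets \<pi>" using that by (intro measurable_if_borel) auto
    have "partial_mean {0..t} = (\<integral>x. indicator {0..s} x * x + indicator {s<..t} x * x \<partial>\<pi>)"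
      unfolding partial_mean_def
      by (rule Bochner_Integration.integral_cong) (use that in \<open>auto simp: indicator_def\<close>)
    also have "\<dots> = partial_mean {0..s} + partial_mean {s<..t}"
      unfolding partial_mean_def
      by (rule Bochner_Integration.integral_add) (use that in \<open>auto intro!: integrable_cell\<close>)
    moreover have "measure \<pi> {0..t} = measure \<pi> {0..s} + measure \<pi> {s<..t}"
      using that by (subst finite_measure_Union[symmetric]) (auto intro!: arg_cong2[where f=measure])
    moreover have "{s<..t} \<subseteq> {0..1}" using that by auto
    ultimately show ?thesis
      using partial_mean_bounds[of "{s<..t}" 0 1] by auto
  qed
  show ?thesis using *[of s t] *[of t s] assms by (cases "s \<le> t") (auto simp: abs_minus_commute)
qed

lemma continuous_partial_mean:
  assumes "atomless \<pi>"
  shows "continuous_on {0..1} (\<lambda>t. partial_mean {0..t})"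
  unfolding continuous_on_iff
proof (intro ballI allI impI)
  fix s e :: real assume s: "s \<in> {0..1}" and "0 < e"
  then obtain d where "d > 0" and d: "\<And>t. t \<in> {0..1} \<Longrightarrow> dist t s < d \<Longrightarrow>
      dist (measure \<pi> {0..t}) (measure \<pi> {0..s}) < e"
    using continuous_mass[OF assms] unfolding continuous_on_iff by blast
  then show "\<exists>d>0. \<forall>t\<in>{0..1}. dist t s < d \<longrightarrow> dist (partial_mean {0..t}) (partial_mean {0..s}) < e"
    using partial_mean_Lipschitz[OF s] unfolding dist_real_def by (meson le_less_trans)
qed

text \<open>Intermediate value theorem to the right of \<open>t\<close>. The hypothesis
  \<open>pos\<close> keeps both denominators away from zero there.\<close>

lemma balanced_cutoff_exists:
  assumes "atomless \<pi>" "0 < b" and t: "t \<in> {0<..<1}"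
    and pos: "\<And>s. s \<in> {t..<1} \<Longrightarrow> 0 < measure \<pi> {0..s} \<and> measure \<pi> {0..s} < 1"
    and ge: "t + b \<le> (Phi_L \<pi> t + Phi_H \<pi> t) / 2"
  shows "\<exists>s\<in>{0<..<1}. s + b = (Phi_L \<pi> s + Phi_H \<pi> s) / 2"
proof -
  \<comment> \<open>The first term keeps \<open>s\<close> strictly above \<open>t\<close>. The
    second gives F(s) <= (1 - s)/2 <= b/2, because the two cell means are at most \<open>s\<close>
    and 1.\<close>
  define s where "s = max ((1 + t) / 2) (1 - b)"
  have s: "t < s" "s < 1" "1 - b \<le> s" "s \<in> {t..<1}" using t \<open>0 < b\<close> by (auto simp: s_def less_max_iff_disj le_max_iff_disj)
  define F where "F r = (Phi_L \<pi> r + Phi_H \<pi> r) / 2 - r" for r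
  have "F s \<le> b"
    using Phi_upper[of s] pos[OF s(4)] s t by (simp add: F_def field_simps)
  moreover have "b \<le> F t" using ge unfolding F_def by linarith
  moreover have "continuous_on {t..s} F"
  proof -
    have sub: "{t..s} \<subseteq> {0..1}" using s t by auto
    have "continuous_on {t..s} (\<lambda>r. (partial_mean {0..r} / measure \<pi> {0..r} +
        (partial_mean {0..1} - partial_mean {0..r}) / (1 - measure \<pi> {0..r})) / 2 - r)"
      using pos s t
      by (intro continuous_intros continuous_on_subset[OF continuous_mass[OF assms(1)] sub]
          continuous_on_subset[OF continuous_partial_mean[OF assms(1)] sub])
         (force simp: order.strict_iff_not)+
    also have "?this \<longleftrightarrow> ?thesis"
      using sub by (intro continuous_on_cong) (auto simp: F_def Phi_eq)
    finally show ?thesis .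
  qed
  ultimately obtain r where "t \<le> r" "r \<le> s" "F r = b"
    using IVT2'[of F s b t] s by auto
  then show ?thesis using s t by (intro bexI[of _ r]) (auto simp: F_def)
qed

end

section \<open>Best responses and beliefs\<close>

text \<open>Bias-variance decomposition: expected utility is minus the squared distance to the mean,
  minus the variance. The maximizer is therefore unique, which rules out mixing by the
  learner.\<close>

lemma is_arg_max_expected_learner_utility:
  assumes "N \<in> space (prob_algebra param_space)"
  shows "(\<integral>x. x \<partial>N) \<in> {0..1}"
    and "is_arg_max (\<lambda>w'. \<integral>x. learner_utility x w' \<partial>N) (\<lambda>w'. w' \<in> {0..1}) w \<longleftrightarrow> w = (\<integral>x. x \<partial>N)"
proof -
  interpret type_distr N by standard (rule assms)
  define \<mu> where "\<mu> = (\<integral>x. x \<partial>N)"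
  have i1: "integrable N (\<lambda>x. x)" by (rule integrable_bounded[where B=1]) auto
  have i2: "integrable N (\<lambda>x. x\<^sup>2)"
    by (rule integrable_bounded[where B=1]) (auto simp: abs_square_le_1)
  have "AE x in N. 0 \<le> x" "AE x in N. x \<le> 1" by (auto intro!: AE_I2 simp: space_type)
  then have \<mu>: "\<mu> \<in> {0..1}"
    using integral_ge_const[OF i1] integral_le_const[OF i1] by (simp add: \<mu>_def)
  have "(\<integral>x. learner_utility x w' \<partial>N) = - (w' - \<mu>)\<^sup>2 - ((\<integral>x. x\<^sup>2 \<partial>N) - \<mu>\<^sup>2)" for w'
  proof -
    have "(\<integral>x. learner_utility x w' \<partial>N) = (\<integral>x. 2 * w' * x - x\<^sup>2 - w'\<^sup>2 \<partial>N)"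
      by (rule Bochner_Integration.integral_cong)
         (auto simp: learner_utility_def power2_eq_square algebra_simps)
    also have "\<dots> = 2 * w' * \<mu> - (\<integral>x. x\<^sup>2 \<partial>N) - w'\<^sup>2"
      using i1 i2 by (simp add: \<mu>_def prob_space)
    finally show ?thesis by (simp add: power2_eq_square algebra_simps)
  qed
  then have "is_arg_max (\<lambda>w'. \<integral>x. learner_utility x w' \<partial>N) (\<lambda>w'. w' \<in> {0..1}) w \<longleftrightarrow>
      w \<in> {0..1} \<and> (\<forall>w'\<in>{0..1}. (w - \<mu>)\<^sup>2 \<le> (w' - \<mu>)\<^sup>2)"
    by (auto simp: is_arg_max_def not_less)
  also have "\<dots> \<longleftrightarrow> w = \<mu>" using \<mu> by force
  finally show "is_arg_max (\<lambda>w'. \<integral>x. learner_utility x w' \<partial>N) (\<lambda>w'. w' \<in> {0..1}) w \<longleftrightarrow> w = (\<integral>x. x \<partial>N)"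
    by (simp add: \<mu>_def)
  show "(\<integral>x. x \<partial>N) \<in> {0..1}" using \<mu> by (simp add: \<mu>_def)
qed

text \<open>Serves to turn a strategy that is almost surely a best response into a point mass when
  the best response is unique.\<close>

lemma AE_eq_imp_return:
  assumes "prob_space M" "sets M = sets N" "c \<in> space N" "AE x in M. x = c"
  shows "M = return N c"
proof (rule measure_eqI)
  interpret prob_space M by fact
  fix A assume A: "A \<in> sets M"
  show "emeasure M A = emeasure (return N c) A"
  proof (cases "c \<in> A")
    case True
    then have "AE x in M. x \<in> A" using assms(4) by (auto elim: eventually_mono)
    then show ?thesis using A True assms by (simp add: emeasure_eq_1_AE)
  next
    case False
    then have "AE x in M. x \<notin> A" using assms(4) by (auto elim: eventually_mono)
    then show ?thesis using A False assms(2) AE_iff_null_sets[OF A] by (simp add: null_setsD1)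
  qed
qed (use assms in simp)

text \<open>Against pure actions, quadratic loss only ranks the distances to the ideal point x +
  b.\<close>

lemma is_arg_max_user_utility_return:
  assumes "\<And>m. m \<in> space R \<Longrightarrow> \<sigma>l m = return param_space (a m) \<and> a m \<in> {0..1}"
    and "m \<in> space R"
  shows "is_arg_max (\<lambda>m'. \<integral>w. user_utility b x w \<partial>\<sigma>l m') (\<lambda>m'. m' \<in> space R) m \<longleftrightarrow>
    (\<forall>m'\<in>space R. \<bar>a m - (x + b)\<bar> \<le> \<bar>a m' - (x + b)\<bar>)"
proof -
  have "user_utility b x \<in> borel_measurable param_space"
    unfolding user_utility_def by (intro measurable_restrict_space1) measurable
  then have "(\<integral>w. user_utility b x w \<partial>\<sigma>l m') = user_utility b x (a m')" if "m' \<in> space R" for m'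
    using assms(1)[OF that] by (simp add: integral_return)
  then show ?thesis
    using assms(2) by (auto simp: is_arg_max_def user_utility_def not_less abs_le_square_iff)
qed

text \<open>For fixed \<open>B\<close> both sides of Bayes' rule are measures in \<open>A\<close>:
  the prior weighted by the probability of a report in \<open>B\<close>, and the mixture of the
  beliefs over the reports in \<open>B\<close>. Equal measures integrate every nonnegative
  \<open>f\<close> alike; the case of interest is the identity, which brings in posterior
  means.\<close>

lemma bayes_belief_nn_integral:
  assumes "\<pi> \<in> space (prob_algebra param_space)" "user_strategy R \<sigma>r" "bayes_belief R \<pi> \<sigma>r \<Phi>"
    and B [measurable]: "B \<in> sets R" and f: "f \<in> borel_measurable param_space"
  shows "(\<integral>\<^sup>+x. emeasure (\<sigma>r x) B * f x \<partial>\<pi>) =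
    (\<integral>\<^sup>+m. indicator B m * (\<integral>\<^sup>+x. f x \<partial>\<Phi> m) \<partial>report_distr \<pi> \<sigma>r)"
proof -
  interpret type_distr \<pi> by standard (rule assms)
  have \<sigma>r [measurable]: "\<sigma>r \<in> \<pi> \<rightarrow>\<^sub>M subprob_algebra R"
    using assms(2) by (auto simp: user_strategy_def measurable_cong_sets[OF sets_type refl]
        intro: measurable_prob_algebraD)
  have sets_rd [measurable_cong]: "sets (report_distr \<pi> \<sigma>r) = sets R"
    unfolding report_distr_def by (rule sets_bind) (auto simp: sets_kernel[OF \<sigma>r] not_empty)
  have space_rd: "space (report_distr \<pi> \<sigma>r) = space R" by (rule sets_eq_imp_space_eq[OF sets_rd])
  have \<Phi> [measurable]: "\<Phi> \<in> R \<rightarrow>\<^sub>M subprob_algebra param_space"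
    and bayes: "\<And>A. A \<in> sets param_space \<Longrightarrow> (\<integral>\<^sup>+x\<in>A. emeasure (\<sigma>r x) B \<partial>\<pi>) =
      (\<integral>\<^sup>+m\<in>B. emeasure (\<Phi> m) A \<partial>report_distr \<pi> \<sigma>r)"
    using assms(3) B by (auto simp: bayes_belief_def intro: measurable_prob_algebraD)
  let ?D = "density (report_distr \<pi> \<sigma>r) (indicator B)"
  \<comment> \<open>\<open>bind\<close> over an empty space is a default value, so a report must
    exist. The law of reports at type 0 provides one.\<close>
  have ne: "space ?D \<noteq> {}"
    using subprob_space.subprob_not_empty[of "\<sigma>r 0"] measurable_space[OF \<sigma>r, of 0]
      subprob_measurableD(1)[OF \<sigma>r, of 0]
    by (auto simp: space_rd space_type space_subprob_algebra)
  have "density \<pi> (\<lambda>x. emeasure (\<sigma>r x) B) = ?D \<bind> \<Phi>"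
  proof (rule measure_eqI)
    show "sets (density \<pi> (\<lambda>x. emeasure (\<sigma>r x) B)) = sets (?D \<bind> \<Phi>)"
      by (subst sets_bind[where N=param_space])
         (use ne in \<open>auto simp: sets_type space_rd sets_kernel[OF \<Phi>]\<close>)
    fix A assume "A \<in> sets (density \<pi> (\<lambda>x. emeasure (\<sigma>r x) B))"
    then have A: "A \<in> sets \<pi>" "A \<in> sets param_space" by (auto simp: sets_type)
    then show "emeasure (density \<pi> (\<lambda>x. emeasure (\<sigma>r x) B)) A = emeasure (?D \<bind> \<Phi>) A"
      using bayes[OF A(2)] ne
      by (subst emeasure_bind[where N=param_space])
         (auto simp: emeasure_density nn_integral_density mult.commute)
  qed
  moreover have "f \<in> borel_measurable \<pi>"
    using f by (simp add: measurable_cong_sets[OF sets_type refl])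
  ultimately have "(\<integral>\<^sup>+x. emeasure (\<sigma>r x) B * f x \<partial>\<pi>) = (\<integral>\<^sup>+x. f x \<partial>(?D \<bind> \<Phi>))"
    by (simp flip: nn_integral_density)
  also have "\<dots> = (\<integral>\<^sup>+m. indicator B m * (\<integral>\<^sup>+x. f x \<partial>\<Phi> m) \<partial>report_distr \<pi> \<sigma>r)"
    using f by (subst nn_integral_bind[where B=param_space]) (auto simp: nn_integral_density)
  finally show ?thesis .
qed

section \<open>From a balanced cutoff to an influential equilibrium\<close>

lemma balanced_cutoff_imp_influential:
  fixes R :: "'m measure"
  assumes "\<pi> \<in> space (prob_algebra param_space)" "full_support \<pi>" "rich_report_space R"
    and "0 < b" and t: "t \<in> {0<..<1}" "t + b = (Phi_L \<pi> t + Phi_H \<pi> t) / 2"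
  shows "learning_influential b R \<pi>"
proof -
  interpret type_distr \<pi> by standard (rule assms)
  have cell [measurable]: "{0..t} \<in> sets \<pi>" "{t<..1} \<in> sets \<pi>" using t by auto
  have pos: "0 < measure \<pi> {0..t}" "0 < measure \<pi> {t<..1}"
  proof -
    have "0 \<in> {..<t} \<inter> {0..1}" "1 \<in> {t<..} \<inter> {0..1}" using t by auto
    then have "0 < measure \<pi> ({..<t} \<inter> {0..1})" "0 < measure \<pi> ({t<..} \<inter> {0..1})"
      using assms(2) unfolding full_support_def by (metis open_lessThan open_greaterThan empty_iff)+
    moreover have "measure \<pi> ({..<t} \<inter> {0..1}) \<le> measure \<pi> {0..t}"
      using t by (intro finite_measure_mono) auto
    moreover have "{t<..} \<inter> {0..1} = {t<..1}" using t by auto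
    ultimately show "0 < measure \<pi> {0..t}" "0 < measure \<pi> {t<..1}" by auto
  qed
  \<comment> \<open>The lower mean is at most \<open>t\<close>, hence strictly below t + b, the
    average of the two means.\<close>
  have less: "Phi_L \<pi> t < Phi_H \<pi> t"
    using Phi_upper(1)[of t] mass_split[of t] pos t \<open>0 < b\<close> by (simp add: field_simps)
  \<comment> \<open>The reports used are the names of the empty set and of the whole interval. Only
    their distinctness counts, since the meaning of a report comes from who sends it.\<close>
  obtain name :: "real set \<Rightarrow> 'm" where "inj_on name (sets param_space)"
    "name ` sets param_space \<subseteq> space R"
    using assms(3) by (auto simp: rich_report_space_def lepoll_def)
  moreover have "{} \<in> sets param_space" "{0..1} \<in> sets param_space"
    using cells(3) by (auto simp: sets_type)
  ultimately have "name {} \<in> space R" "name {0..1} \<in> space R" "name {} \<noteq> name {0..1}"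
    by (auto simp: image_subset_iff dest!: inj_onD[of name "sets param_space" "{}" "{0..1}"])
  then obtain l h where lh: "l \<in> space R" "h \<in> space R" "l \<noteq> h" by blast
  then have sing [measurable]: "{l} \<in> sets R" "{h} \<in> sets R"
    using assms(3) by (auto simp: rich_report_space_def)
  define r where "r x = (if x \<le> t then l else h)" for x
  \<comment> \<open>Every report other than \<open>h\<close>, sent or not, is read as
    \<open>l\<close>. A deviation thus never produces a third action, and all objects indexed by
    reports take just two values.\<close>
  define c where "c m = (if m = h then {t<..1} else {0..t})" for m
  define a where "a m = cond_mean \<pi> (c m)" for m
  define \<Phi> where "\<Phi> m = uniform_measure \<pi> (c m)" for m
  define \<sigma>r where "\<sigma>r x = return R (r x)" for x
  define \<sigma>l where "\<sigma>l m = return param_space (a m)" for m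
  have c: "c m \<in> sets \<pi>" "0 < measure \<pi> (c m)" for m using pos by (auto simp: c_def)
  have r_space: "r x \<in> space R" for x using lh by (auto simp: r_def)
  have r [measurable]: "r \<in> \<pi> \<rightarrow>\<^sub>M R"
    unfolding r_def using lh by (intro measurable_If) auto
  have \<Phi>_space: "\<Phi> m \<in> space (prob_algebra param_space)" for m
    using c[of m] by (auto simp: \<Phi>_def space_prob_algebra sets_type emeasure_eq_measure
        intro!: prob_space_uniform_measure)
  have \<Phi>_mean: "(\<integral>x. x \<partial>\<Phi> m) = a m" for m
  proof -
    have "\<Phi> m = density \<pi> (\<lambda>x. ennreal (indicator (c m) x / measure \<pi> (c m)))"
      using c[of m] by (simp add: \<Phi>_def uniform_measure_def emeasure_eq_measure
          divide_ennreal ennreal_indicator[symmetric] del: ennreal_indicator)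
    then have "(\<integral>x. x \<partial>\<Phi> m) = (\<integral>x. (indicator (c m) x * x) / measure \<pi> (c m) \<partial>\<pi>)"
      using c[of m] by (simp add: integral_density)
    also have "\<dots> = a m" by (simp add: a_def cond_mean_eq partial_mean_def)
    finally show ?thesis .
  qed
  have a01: "a m \<in> {0..1}" for m
    using is_arg_max_expected_learner_utility(1)[OF \<Phi>_space[of m]] by (simp add: \<Phi>_mean)
  have is_report: "{m \<in> space R. m = k} \<in> sets R" if "k \<in> {l, h}" for k
  proof -
    have "{m \<in> space R. m = k} = {k}" using lh that by auto
    then show ?thesis using sing that by auto
  qed
  have two_valued: "(\<lambda>m. if m = h then u else v) \<in> R \<rightarrow>\<^sub>M N" if "u \<in> space N" "v \<in> space N"
    for u v :: 'n and N
    using that is_report[of h] by (intro measurable_If) auto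
  have rd: "report_distr \<pi> \<sigma>r = distr \<pi> R r"
    unfolding report_distr_def \<sigma>r_def using not_empty by (intro bind_return_distr') auto
  have "user_strategy R \<sigma>r"
    unfolding user_strategy_def \<sigma>r_def
    using measurable_compose[OF r measurable_return_prob_space]
    by (simp add: measurable_cong_sets[OF sets_type refl])
  moreover have "learner_strategy R \<sigma>l"
  proof -
    have "\<sigma>l = (\<lambda>m. if m = h then \<sigma>l h else \<sigma>l l)"
      using lh by (auto simp: \<sigma>l_def a_def c_def)
    moreover have "\<sigma>l m \<in> space (prob_algebra param_space)" for m
      using a01[of m] by (auto simp: \<sigma>l_def space_prob_algebra intro!: prob_space_return)
    ultimately show ?thesis
      unfolding learner_strategy_def by (subst \<open>\<sigma>l = _\<close>) (intro two_valued)
  qed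
  moreover have "user_optimal b R \<sigma>r \<sigma>l"
    unfolding user_optimal_def
  proof
    fix x :: real assume "x \<in> {0..1}"
    have "AE m in \<sigma>r x. m = r x"
      unfolding \<sigma>r_def using is_report[of "r x"]
      by (subst AE_return[OF r_space]) (simp_all add: r_def pred_def)
    \<comment> \<open>As t + b is the midpoint of the two means, types up to \<open>t\<close> are at
      least as close to the lower one, and types above \<open>t\<close> are closer to the upper
      one.\<close>
    moreover have "is_arg_max (\<lambda>m'. \<integral>w. user_utility b x w \<partial>\<sigma>l m') (\<lambda>m'. m' \<in> space R) (r x)"
      using a01 r_space t(2) less lh
      by (subst is_arg_max_user_utility_return[where a=a])
         (auto simp: \<sigma>l_def a_def c_def r_def Phi_L_def Phi_H_def abs_if field_simps)
    ultimately show "AE m in \<sigma>r x.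
        is_arg_max (\<lambda>m'. \<integral>w. user_utility b x w \<partial>\<sigma>l m') (\<lambda>m'. m' \<in> space R) m"
      by (auto elim: eventually_mono)
  qed
  moreover have "bayes_belief R \<pi> \<sigma>r \<Phi>"
    unfolding bayes_belief_def
  proof (intro conjI ballI)
    have eq: "\<Phi> = (\<lambda>m. if m = h then \<Phi> h else \<Phi> l)"
      using lh by (auto simp: \<Phi>_def c_def)
    show \<Phi>_meas: "\<Phi> \<in> R \<rightarrow>\<^sub>M prob_algebra param_space"
      by (subst eq) (intro two_valued \<Phi>_space)
    fix A B assume A': "A \<in> sets param_space" and B [measurable]: "B \<in> sets R"
    have A [measurable]: "A \<in> sets \<pi>" using A' by (simp add: sets_type)
    have "(\<lambda>m. emeasure (\<Phi> m) A) \<in> borel_measurable R"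
      using measurable_compose[OF measurable_prob_algebraD[OF \<Phi>_meas]
          measurable_emeasure_subprob_algebra[OF A']] by simp
    then have "(\<integral>\<^sup>+m\<in>B. emeasure (\<Phi> m) A \<partial>report_distr \<pi> \<sigma>r) =
        (\<integral>\<^sup>+x. emeasure (\<Phi> (r x)) A * indicator B (r x) \<partial>\<pi>)"
      unfolding rd by (subst nn_integral_distr) auto
    also have "\<dots> = (\<integral>\<^sup>+x. emeasure (\<Phi> l) A * indicator B l * indicator {0..t} x +
        emeasure (\<Phi> h) A * indicator B h * indicator {t<..1} x \<partial>\<pi>)"
      by (rule nn_integral_cong) (auto simp: r_def space_type indicator_def)
    \<comment> \<open>The normalisation in each belief cancels against the mass of its cell, which
      is positive.\<close>
    also have "\<dots> = indicator B l * emeasure \<pi> ({0..t} \<inter> A) + indicator B h * emeasure \<pi> ({t<..1} \<inter> A)"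
      using pos lh
      by (subst nn_integral_add; cases "l \<in> B"; cases "h \<in> B")
         (auto simp: nn_integral_cmult \<Phi>_def c_def emeasure_eq_measure divide_ennreal
            ennreal_mult[symmetric])
    also have "\<dots> = (\<integral>\<^sup>+x. indicator B l * indicator ({0..t} \<inter> A) x +
        indicator B h * indicator ({t<..1} \<inter> A) x \<partial>\<pi>)"
      by (subst nn_integral_add) (auto simp: nn_integral_cmult)
    also have "\<dots> = (\<integral>\<^sup>+x\<in>A. emeasure (\<sigma>r x) B \<partial>\<pi>)"
      by (rule nn_integral_cong) (auto simp: \<sigma>r_def r_def space_type indicator_def)
    finally show "(\<integral>\<^sup>+x\<in>A. emeasure (\<sigma>r x) B \<partial>\<pi>) =
      (\<integral>\<^sup>+m\<in>B. emeasure (\<Phi> m) A \<partial>report_distr \<pi> \<sigma>r)" by simp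
  qed
  moreover have "learner_optimal R \<sigma>l \<Phi>"
    unfolding learner_optimal_def \<sigma>l_def is_arg_max_expected_learner_utility(2)[OF \<Phi>_space] \<Phi>_mean
  proof
    fix m
    have "{w \<in> space param_space. w = a m} = {a m}" using a01[of m] by auto
    then have "Measurable.pred param_space (\<lambda>w. w = a m)"
      using a01[of m] by (simp only: pred_def) (simp add: sets_restrict_space_iff)
    then show "AE w in return param_space (a m). w = a m"
      using a01[of m] by (simp add: AE_return)
  qed
  moreover have "influential R \<pi> \<sigma>r \<sigma>l"
    unfolding influential_def
  proof (rule bexI[of _ l], rule bexI[of _ h], intro conjI)
    have "r -` {l} \<inter> space \<pi> = {0..t}" "r -` {h} \<inter> space \<pi> = {t<..1}"
      using lh t by (auto simp: r_def space_type split: if_splits)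
    then show "0 < measure (report_distr \<pi> \<sigma>r) {l}" "0 < measure (report_distr \<pi> \<sigma>r) {h}"
      using pos by (auto simp: rd measure_distr)
    have "a l \<noteq> a h" using less lh by (simp add: a_def c_def Phi_L_def Phi_H_def)
    then have "emeasure (\<sigma>l l) {a l} \<noteq> emeasure (\<sigma>l h) {a l}"
      using a01[of l] by (simp add: \<sigma>l_def sets_restrict_space_iff)
    then show "\<sigma>l l \<noteq> \<sigma>l h" by auto
  qed (use lh in auto)
  ultimately show ?thesis
    unfolding learning_influential_def equilibrium_def by blast
qed

section \<open>From an influential equilibrium to a balanced cutoff\<close>

text \<open>The equilibrium is translated into a joint law of type and action, to which
  \<open>lowest_action_cutoff\<close> applies; its conclusion is then carried back to the prior,
  where continuity turns the inequality into a balanced cutoff.\<close>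

lemma influential_imp_balanced_cutoff:
  assumes "0 < b" "\<pi> \<in> space (prob_algebra param_space)" "atomless \<pi>" "full_support \<pi>"
    and equi: "equilibrium b R \<pi> \<sigma>r \<sigma>l" and infl: "influential R \<pi> \<sigma>r \<sigma>l"
  shows "\<exists>t\<in>{0<..<1}. t + b = (Phi_L \<pi> t + Phi_H \<pi> t) / 2"
proof -
  interpret type_distr \<pi> by standard (rule assms)
  obtain \<Phi> where \<sigma>r_strat: "user_strategy R \<sigma>r" and \<sigma>l_strat: "learner_strategy R \<sigma>l"
    and uopt: "user_optimal b R \<sigma>r \<sigma>l" and bayes: "bayes_belief R \<pi> \<sigma>r \<Phi>"
    and lopt: "learner_optimal R \<sigma>l \<Phi>"
    using equi by (auto simp: equilibrium_def)
  have \<sigma>r_prob [measurable]: "\<sigma>r \<in> \<pi> \<rightarrow>\<^sub>M prob_algebra R"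
    using \<sigma>r_strat by (simp add: user_strategy_def measurable_cong_sets[OF sets_type refl])
  have \<sigma>r [measurable]: "\<sigma>r \<in> \<pi> \<rightarrow>\<^sub>M subprob_algebra R"
    by (rule measurable_prob_algebraD) measurable
  have \<sigma>r_sets: "sets (\<sigma>r x) = sets R" and \<sigma>r_prob_space: "prob_space (\<sigma>r x)"
    if "x \<in> space \<pi>" for x
    using measurable_space[OF \<sigma>r_prob that] by (auto simp: space_prob_algebra)
  have \<Phi>: "\<Phi> \<in> R \<rightarrow>\<^sub>M prob_algebra param_space"
    using bayes by (simp add: bayes_belief_def)
  define a where "a m = (\<integral>x. x \<partial>\<Phi> m)" for m
  have \<Phi>_space: "\<Phi> m \<in> space (prob_algebra param_space)" if "m \<in> space R" for m
    using measurable_space[OF \<Phi> that] .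
  have a01: "a m \<in> {0..1}" if "m \<in> space R" for m
    unfolding a_def by (rule is_arg_max_expected_learner_utility(1)[OF \<Phi>_space[OF that]])
  have a_meas [measurable]: "a \<in> borel_measurable R"
    unfolding a_def
    by (rule measurable_compose[OF measurable_prob_algebraD[OF \<Phi>] integral_measurable_subprob_algebra])
       (simp add: measurable_restrict_space1)
  have \<sigma>l: "\<sigma>l m = return param_space (a m)" if m: "m \<in> space R" for m
  proof (rule AE_eq_imp_return)
    have "\<sigma>l m \<in> space (prob_algebra param_space)"
      using \<sigma>l_strat m by (auto simp: learner_strategy_def dest: measurable_space)
    then show "prob_space (\<sigma>l m)" "sets (\<sigma>l m) = sets param_space"
      by (auto simp: space_prob_algebra)
    show "a m \<in> space param_space" using a01[OF m] by simp
    show "AE w in \<sigma>l m. w = a m"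
      using lopt m unfolding learner_optimal_def a_def
        is_arg_max_expected_learner_utility(2)[OF \<Phi>_space[OF m], symmetric] by blast
  qed

  \<comment> \<open>The user may mix, so the action is random even given the type.
    \<open>K x\<close> is the law of the pair at type \<open>x\<close>, and \<open>J\<close>
    averages it over the prior; the report itself is forgotten.\<close>
  define K where "K x = distr (\<sigma>r x) (borel \<Otimes>\<^sub>M borel) (\<lambda>m. (x, a m))" for x
  define J where "J = \<pi> \<bind> K"
  have K_prob: "K \<in> \<pi> \<rightarrow>\<^sub>M prob_algebra (borel \<Otimes>\<^sub>M borel)"
    unfolding K_def by (rule measurable_distr_prob_space2[OF \<sigma>r_prob]) measurable
  have K [measurable]: "K \<in> \<pi> \<rightarrow>\<^sub>M subprob_algebra (borel \<Otimes>\<^sub>M borel)"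
    by (rule measurable_prob_algebraD[OF K_prob])
  have sets_J [measurable_cong]: "sets J = sets (borel \<Otimes>\<^sub>M borel)"
    unfolding J_def by (rule sets_bind) (auto simp: K_def not_empty)
  have act [measurable]: "(\<lambda>m. (x, a m)) \<in> \<sigma>r x \<rightarrow>\<^sub>M borel \<Otimes>\<^sub>M borel" if "x \<in> space \<pi>" for x
    by (simp add: measurable_cong_sets[OF \<sigma>r_sets[OF that] refl])
  have "prob_space J"
    unfolding J_def
  proof (rule prob_space_bind[OF _ K])
    show "AE x in \<pi>. prob_space (K x)"
      by (rule AE_I2) (auto simp: K_def intro!: prob_space.prob_space_distr \<sigma>r_prob_space act)
  qed
  then interpret J: prob_space J .
  have AE_J: "(AE p in J. P (fst p) (snd p)) \<longleftrightarrow> (AE x in \<pi>. AE m in \<sigma>r x. P x (a m))"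
    if [measurable]: "Measurable.pred (borel \<Otimes>\<^sub>M borel) (\<lambda>p. P (fst p) (snd p))" for P
  proof -
    have "(AE p in J. P (fst p) (snd p)) \<longleftrightarrow> (AE x in \<pi>. AE p in K x. P (fst p) (snd p))"
      unfolding J_def by (rule AE_bind[OF K]) simp
    also have "\<dots> \<longleftrightarrow> (AE x in \<pi>. AE m in \<sigma>r x. P x (a m))"
    proof (rule AE_cong)
      fix x assume "x \<in> space \<pi>"
      then show "(AE p in K x. P (fst p) (snd p)) \<longleftrightarrow> (AE m in \<sigma>r x. P x (a m))"
        using AE_distr_iff[OF act that[unfolded pred_def]] by (simp only: K_def fst_conv snd_conv)
    qed
    finally show ?thesis .
  qed
  have nn_J: "(\<integral>\<^sup>+p. f p \<partial>J) = (\<integral>\<^sup>+x. \<integral>\<^sup>+m. f (x, a m) \<partial>\<sigma>r x \<partial>\<pi>)"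
    if [measurable]: "f \<in> borel_measurable (borel \<Otimes>\<^sub>M borel)" for f
    unfolding J_def
    by (subst nn_integral_bind[OF that K])
       (auto intro!: nn_integral_cong simp: K_def nn_integral_distr[OF act])
  have AE_I: "AE x in \<pi>. AE m in \<sigma>r x. P x m" if "\<And>x m. x \<in> {0..1} \<Longrightarrow> m \<in> space R \<Longrightarrow> P x m" for P
  proof (intro AE_I2)
    fix x m assume x: "x \<in> space \<pi>" and "m \<in> space (\<sigma>r x)"
    then show "P x m"
      using that sets_eq_imp_space_eq[OF \<sigma>r_sets[OF x]] by (auto simp: space_type)
  qed
  have fst_law: "distr J borel fst = distr \<pi> borel (\<lambda>x. x)"
  proof (rule measure_eqI)
    fix A assume "A \<in> sets (distr J borel fst)"
    then have A [measurable]: "A \<in> sets borel" by simp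
    have "emeasure (distr J borel fst) A = (\<integral>\<^sup>+p. indicator A (fst p) \<partial>J)"
      by (simp flip: nn_integral_indicator add: nn_integral_distr)
    also have "\<dots> = (\<integral>\<^sup>+x. indicator A x \<partial>\<pi>)"
      by (subst nn_J) (auto intro!: nn_integral_cong simp: prob_space.emeasure_space_1 \<sigma>r_prob_space)
    also have "\<dots> = emeasure (distr \<pi> borel (\<lambda>x. x)) A"
      by (simp flip: nn_integral_indicator add: nn_integral_distr)
    finally show "emeasure (distr J borel fst) A = emeasure (distr \<pi> borel (\<lambda>x. x)) A" .
  qed simp
  have prob_fst: "measure J {p \<in> space J. fst p \<in> A} = measure \<pi> (A \<inter> {0..1})"
    if [measurable]: "A \<in> sets borel" for A
  proof -
    have "measure J {p \<in> space J. fst p \<in> A} = measure (distr J borel fst) A"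
      by (simp add: measure_distr vimage_def Int_def conj_commute)
    also have "\<dots> = measure \<pi> (A \<inter> {0..1})"
      by (simp add: fst_law measure_distr space_type vimage_def Int_def)
    finally show ?thesis .
  qed
  have int_fst: "(\<integral>p. indicator A (fst p) * fst p \<partial>J) = partial_mean (A \<inter> {0..1})"
    if [measurable]: "A \<in> sets borel" for A
  proof -
    have "(\<integral>p. indicator A (fst p) * fst p \<partial>J) = (\<integral>x. indicator A x * x \<partial>distr J borel fst)"
      by (subst integral_distr) auto
    also have "\<dots> = (\<integral>x. indicator A x * x \<partial>\<pi>)"
      by (simp add: fst_law integral_distr)
    also have "\<dots> = partial_mean (A \<inter> {0..1})"
      unfolding partial_mean_def
      by (rule Bochner_Integration.integral_cong) (auto simp: space_type indicator_def)
    finally show ?thesis .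
  qed

  have X01: "AE p in J. fst p \<in> {0..1}"
    using AE_J[of "\<lambda>x y. x \<in> {0..1}"] AE_I[of "\<lambda>x m. x \<in> {0..1}"] by simp
  have Y01: "AE p in J. snd p \<in> {0..1}"
    using AE_J[of "\<lambda>x y. y \<in> {0..1}"] AE_I[of "\<lambda>x m. a m \<in> {0..1}"] a01 by simp
  \<comment> \<open>The closure is needed for measurability: the image of the report space need not be a Borel set.\<close>
  have Jopt: "AE p in J. snd p \<in> closure (a ` space R) \<and>
      (\<forall>s\<in>closure (a ` space R). \<bar>snd p - (fst p + b)\<bar> \<le> \<bar>s - (fst p + b)\<bar>)"
  proof -
    let ?S = "closure (a ` space R)"
    have [measurable]: "?S \<in> sets borel" by simp
    \<comment> \<open>The quantifier over a possibly uncountable set of actions is replaced by one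
      comparison with the distance function, which is continuous. This makes the predicate
      measurable, as \<open>AE_J\<close> demands.\<close>
    have "(\<lambda>x. infdist x ?S) \<in> borel_measurable borel"
      by (intro borel_measurable_continuous_onI continuous_intros)
    then have [measurable]: "(\<lambda>p. infdist (fst p + b) ?S) \<in> borel_measurable (borel \<Otimes>\<^sub>M borel)"
      by (rule measurable_compose[rotated]) measurable
    have pred: "Measurable.pred (borel \<Otimes>\<^sub>M borel)
        (\<lambda>p. snd p \<in> ?S \<and> \<bar>snd p - (fst p + b)\<bar> \<le> infdist (fst p + b) ?S)"
      by measurable
    have "AE x in \<pi>. AE m in \<sigma>r x. a m \<in> ?S \<and> \<bar>a m - (x + b)\<bar> \<le> infdist (x + b) ?S"
    proof (rule AE_I2)
      fix x assume x: "x \<in> space \<pi>"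
      then have "AE m in \<sigma>r x.
          is_arg_max (\<lambda>m'. \<integral>w. user_utility b x w \<partial>\<sigma>l m') (\<lambda>m'. m' \<in> space R) m"
        using uopt by (auto simp: user_optimal_def space_type)
      moreover have "AE m in \<sigma>r x. m \<in> space R"
        using sets_eq_imp_space_eq[OF \<sigma>r_sets[OF x]] by (intro AE_I2) auto
      ultimately show "AE m in \<sigma>r x. a m \<in> ?S \<and> \<bar>a m - (x + b)\<bar> \<le> infdist (x + b) ?S"
      proof eventually_elim
        case (elim m)
        then have "\<forall>m'\<in>space R. \<bar>a m - (x + b)\<bar> \<le> \<bar>a m' - (x + b)\<bar>"
          using is_arg_max_user_utility_return[of R \<sigma>l a m b x] \<sigma>l a01 by blast
        \<comment> \<open>Being at least as far from x + b as \<open>a m\<close> is a closed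
          condition, so optimality against the available actions extends to their limits.\<close>
        then have "a ` space R \<subseteq> {s. \<bar>a m - (x + b)\<bar> \<le> \<bar>s - (x + b)\<bar>}" by auto
        moreover have "closed {s. \<bar>a m - (x + b)\<bar> \<le> \<bar>s - (x + b)\<bar>}"
          by (intro closed_Collect_le continuous_intros)
        ultimately have "?S \<subseteq> {s. \<bar>a m - (x + b)\<bar> \<le> \<bar>s - (x + b)\<bar>}"
          by (rule closure_minimal)
        moreover have am: "a m \<in> ?S" using elim(2) by (intro closure_subset[THEN subsetD] imageI)
        moreover have "?S \<noteq> {}" using am by (metis empty_iff)
        ultimately have "\<bar>a m - (x + b)\<bar> \<le> infdist (x + b) ?S"
          unfolding infdist_notempty[OF \<open>?S \<noteq> {}\<close>]
          by (intro cINF_greatest) (auto simp: dist_real_def abs_minus_commute simp del: closure_eq_empty)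
        with am show ?case by simp
      qed
    qed
    then have "AE p in J. snd p \<in> ?S \<and> \<bar>snd p - (fst p + b)\<bar> \<le> infdist (fst p + b) ?S"
      using AE_J[OF pred] by blast
    then show ?thesis
    proof eventually_elim
      case (elim p)
      have "\<bar>snd p - (fst p + b)\<bar> \<le> \<bar>s - (fst p + b)\<bar>" if "s \<in> ?S" for s
        using elim infdist_le[OF that, of "fst p + b"] by (simp add: dist_real_def abs_minus_commute)
      with elim show ?case by blast
    qed
  qed
  \<comment> \<open>The event on actions is pulled back to the set \<open>B\<close> of reports,
    where the integrated Bayes rule for the identity replaces the type by the posterior mean
    \<open>a m\<close>. The computation uses nonnegative integrals, which is harmless for values in
    the unit interval.\<close>
  have mean: "(\<integral>p. indicator A (snd p) * fst p \<partial>J) = (\<integral>p. indicator A (snd p) * snd p \<partial>J)"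
    if [measurable]: "A \<in> sets borel" for A
  proof -
    define B where "B = a -` A \<inter> space R"
    have B [measurable]: "B \<in> sets R" unfolding B_def by measurable
    have ind: "indicator A (a m) = (indicator B m :: ennreal)" if "x \<in> space \<pi>" "m \<in> space (\<sigma>r x)" for x m
      using that sets_eq_imp_space_eq[OF \<sigma>r_sets] by (auto simp: B_def indicator_def)
    have "(\<integral>\<^sup>+p. ennreal (indicator A (snd p) * fst p) \<partial>J) =
        (\<integral>\<^sup>+x. \<integral>\<^sup>+m. ennreal x * indicator B m \<partial>\<sigma>r x \<partial>\<pi>)"
      by (subst nn_J)
         (auto intro!: nn_integral_cong simp: ind[symmetric] space_type split: split_indicator)
    also have "\<dots> = (\<integral>\<^sup>+x. emeasure (\<sigma>r x) B * ennreal x \<partial>\<pi>)"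
      by (intro nn_integral_cong) (simp add: nn_integral_cmult \<sigma>r_sets mult.commute)
    also have "\<dots> = (\<integral>\<^sup>+m. indicator B m * (\<integral>\<^sup>+x. ennreal x \<partial>\<Phi> m) \<partial>report_distr \<pi> \<sigma>r)"
      by (rule bayes_belief_nn_integral[OF assms(2) \<sigma>r_strat bayes B])
         (simp add: measurable_restrict_space1)
    also have "\<dots> = (\<integral>\<^sup>+m. indicator B m * ennreal (a m) \<partial>report_distr \<pi> \<sigma>r)"
    proof (rule nn_integral_cong)
      fix m assume "m \<in> space (report_distr \<pi> \<sigma>r)"
      then have "m \<in> space R"
        unfolding report_distr_def by (subst (asm) space_bind[where N=R]) (auto simp: \<sigma>r_sets not_empty)
      then interpret \<Phi>m: type_distr "\<Phi> m" by unfold_locales (rule \<Phi>_space)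
      have "(\<integral>\<^sup>+x. ennreal x \<partial>\<Phi> m) = ennreal (a m)"
        unfolding a_def
        by (rule nn_integral_eq_integral)
           (auto intro!: \<Phi>m.integrable_bounded[where B=1] AE_I2 simp: \<Phi>m.space_type)
      then show "indicator B m * (\<integral>\<^sup>+x. ennreal x \<partial>\<Phi> m) = indicator B m * ennreal (a m)" by simp
    qed
    also have "\<dots> = (\<integral>\<^sup>+x. \<integral>\<^sup>+m. indicator B m * ennreal (a m) \<partial>\<sigma>r x \<partial>\<pi>)"
      unfolding report_distr_def by (rule nn_integral_bind[OF _ \<sigma>r]) measurable
    also have "\<dots> = (\<integral>\<^sup>+p. ennreal (indicator A (snd p) * snd p) \<partial>J)"
      by (subst nn_J) (auto intro!: nn_integral_cong simp: ind[symmetric] split: split_indicator)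
    finally have eq: "(\<integral>\<^sup>+p. ennreal (indicator A (snd p) * fst p) \<partial>J) =
      (\<integral>\<^sup>+p. ennreal (indicator A (snd p) * snd p) \<partial>J)" .
    have "AE p in J. 0 \<le> indicator A (snd p) * fst p" "AE p in J. 0 \<le> indicator A (snd p) * snd p"
      using X01 Y01 by (eventually_elim; simp add: indicator_def)+
    then show ?thesis using eq by (simp add: integral_eq_nn_integral)
  qed
  have Jatomless: "AE p in J. fst p \<noteq> x" for x
  proof -
    have "measure J {p \<in> space J. fst p \<in> {x}} = 0"
      using assms(3) by (subst prob_fst) (auto simp: atomless_def space_type Int_insert_left)
    then show ?thesis
      by (subst AE_iff_measurable[OF _ refl]) (auto simp: J.emeasure_eq_measure)
  qed
  have nonconst: "\<not> (AE p in J. snd p = c)" for c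
  proof
    assume "AE p in J. snd p = c"
    then have ae: "AE m in report_distr \<pi> \<sigma>r. a m = c"
      unfolding report_distr_def by (subst AE_bind[OF \<sigma>r]) (use AE_J[of "\<lambda>x y. y = c"] in auto)
    \<comment> \<open>A report of positive probability escapes the null set where the action differs
      from \<open>c\<close>. Two such reports would then receive the same point mass, against
      influence.\<close>
    have "a m = c" if "0 < measure (report_distr \<pi> \<sigma>r) {m}" for m
    proof (rule ccontr)
      assume "a m \<noteq> c"
      with ae have "AE x in report_distr \<pi> \<sigma>r. x \<notin> {m}"
        by (auto elim!: eventually_mono)
      \<comment> \<open>A set that is not measurable has measure 0 by convention, so positive
        measure already implies measurability.\<close>
      moreover have "{m} \<in> sets (report_distr \<pi> \<sigma>r)"
        using that by (metis measure_notin_sets less_irrefl)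
      ultimately have "{m} \<in> null_sets (report_distr \<pi> \<sigma>r)"
        by (simp only: AE_iff_null_sets)
      then show False using that by (simp add: null_sets_def measure_def)
    qed
    then show False using infl \<sigma>l unfolding influential_def by metis
  qed

  have rv: "fst \<in> borel_measurable J" "snd \<in> borel_measurable J" by measurable
  obtain t L q where t: "0 < measure J {p \<in> space J. fst p \<le> t}" "0 < measure J {p \<in> space J. t < fst p}"
    "(\<integral>p. indicator {..t} (fst p) * fst p \<partial>J) = L * measure J {p \<in> space J. fst p \<le> t}"
    "q * measure J {p \<in> space J. t < fst p} \<le> (\<integral>p. indicator {t<..} (fst p) * fst p \<partial>J)"
    "L + q = 2 * (t + b)"
    using J.lowest_action_cutoff[OF rv X01 Y01 \<open>0 < b\<close> closed_closure Jopt mean Jatomless nonconst]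
    by blast
  \<comment> \<open>The lower cell has positive mass, while for t <= 0 it would contain at most the
    point 0, which is no atom.\<close>
  have "0 < t"
  proof (rule ccontr)
    assume "\<not> 0 < t"
    then have "{..t} \<inter> {0..1} \<subseteq> {0}" by auto
    then have "measure \<pi> ({..t} \<inter> {0..1}) \<le> measure \<pi> {0}"
      by (intro finite_measure_mono measurable_if_borel) auto
    then show False using t(1) prob_fst[of "{..t}"] assms(3) by (simp add: atomless_def space_type)
  qed
  have "t < 1"
  proof (rule ccontr)
    assume "\<not> t < 1"
    then have "{t<..} \<inter> {0..1} = {}" by auto
    then show False using t(2) prob_fst[of "{t<..}"] by simp
  qed
  have cells: "{..t} \<inter> {0..1} = {0..t}" "{t<..} \<inter> {0..1} = {t<..1}"
    using \<open>0 < t\<close> \<open>t < 1\<close> by auto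
  have law: "measure J {p \<in> space J. fst p \<le> t} = measure \<pi> {0..t}"
    "measure J {p \<in> space J. t < fst p} = measure \<pi> {t<..1}"
    "(\<integral>p. indicator {..t} (fst p) * fst p \<partial>J) = partial_mean {0..t}"
    "(\<integral>p. indicator {t<..} (fst p) * fst p \<partial>J) = partial_mean {t<..1}"
    using prob_fst[of "{..t}", unfolded cells] prob_fst[of "{t<..}", unfolded cells]
      int_fst[of "{..t}", unfolded cells] int_fst[of "{t<..}", unfolded cells] by simp_all
  have pos: "0 < measure \<pi> {0..t}" "0 < measure \<pi> {t<..1}"
    and "partial_mean {0..t} = L * measure \<pi> {0..t}"
    and "q * measure \<pi> {t<..1} \<le> partial_mean {t<..1}"
    using t(1-4) unfolding law by auto
  then have "Phi_L \<pi> t = L" "q \<le> Phi_H \<pi> t"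
    by (auto simp: Phi_L_def Phi_H_def cond_mean_eq field_simps)
  then have "t + b \<le> (Phi_L \<pi> t + Phi_H \<pi> t) / 2" using t(5) by simp
  \<comment> \<open>The lower cell grows with \<open>s\<close>, and full support gives mass to every
    neighbourhood of 1.\<close>
  moreover have "0 < measure \<pi> {0..s} \<and> measure \<pi> {0..s} < 1" if s: "s \<in> {t..<1}" for s
  proof -
    have "measure \<pi> {0..t} \<le> measure \<pi> {0..s}"
      using s by (intro finite_measure_mono) auto
    moreover have "0 < measure \<pi> {s<..1}"
    proof -
      have "{s<..} \<inter> {0..1} = {s<..1}" using s \<open>0 < t\<close> by auto
      moreover have "1 \<in> {s<..} \<inter> {0..1}" using s by auto
      ultimately show ?thesis using assms(4) unfolding full_support_def by (metis open_greaterThan empty_iff)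
    qed
    ultimately show ?thesis
      using \<open>0 < measure \<pi> {0..t}\<close> mass_split[of s] s \<open>0 < t\<close> by auto
  qed
  ultimately show ?thesis
    using balanced_cutoff_exists[OF assms(3,1)] \<open>0 < t\<close> \<open>t < 1\<close> by simp
qed

theorem theorem4p1:
  fixes b :: real and \<pi> :: "real measure" and R :: "'m measure"
  assumes "b > 0"
    and "\<pi> \<in> space (prob_algebra param_space)"
    and "atomless \<pi>"
    and "full_support \<pi>"
    and "rich_report_space R"
  shows "learning_influential b R \<pi> \<longleftrightarrow>
    (\<exists>t\<in>{0<..<1}. t + b = (Phi_L \<pi> t + Phi_H \<pi> t) / 2)"
proof
  assume "learning_influential b R \<pi>"
  then show "\<exists>t\<in>{0<..<1}. t + b = (Phi_L \<pi> t + Phi_H \<pi> t) / 2"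
    unfolding learning_influential_def
    using influential_imp_balanced_cutoff[OF assms(1-4)] by blast
next
  assume "\<exists>t\<in>{0<..<1}. t + b = (Phi_L \<pi> t + Phi_H \<pi> t) / 2"
  then show "learning_influential b R \<pi>"
    using balanced_cutoff_imp_influential[OF assms(2,4,5,1)] by blast
qed

end
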